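(* For any $\alpha\in\left[\frac1{n+1},1\right)$, the upper StableCP-region is the region enclosed by the $\Gamma^{-1}$-ellipsoid centred at $\hat f_{\lambda^+;D}(X_{n+1})$ with radius $\widehat Q^{\Gamma,\mathrm{up}}_{\lambda;D^+}(\alpha)+\widehat\tau^\Gamma_\lambda(X_{n+1})$, that is, $$\widetilde C^{\Gamma,\mathrm{up}}_{\lambda;\alpha}(X_{n+1})=\left\{y\in\mathcal{Y}:\left\|\Gamma^{-1/2}\left(y-\hat f_{\lambda^+;D}(X_{n+1})\right)\right\|\le\widehat Q^{\Gamma,\mathrm{up}}_{\lambda;D^+}(\alpha)+\widehat\tau^\Gamma_\lambda(X_{n+1})\right\},$$ where $\widehat Q^{\Gamma,\mathrm{up}}_{\lambda;D^+}(\alpha)$ is the $i$-th smallest of the $n$ values $\left\|\Gamma^{-1/2}(Y_j-\hat f_{\lambda^+;D}(X_j))\right\|+\widehat\tau^\Gamma_\lambda(X_j)$, $j=1,\dots,n$, with $i=\lceil(n+1)(1-\alpha)\rceil$.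
   Context: $\mathcal{X}\subset\mathbb{R}^d$, $\mathcal{Y}\subset\mathbb{R}^p$, $(X_1,Y_1),\dots,(X_n,Y_n)\in\mathcal{X}\times\mathcal{Y}$, $X_{n+1}\in\mathcal{X}$, $\lambda\in(0,+\infty)$, $\lambda^+:=\frac{n+1}n\lambda$, and $\Gamma\in\mathbb{R}^{p\times p}$ symmetric positive definite. $\mathcal{H}$ is a reproducing kernel Hilbert space of functions $\mathcal{X}\to\mathbb{R}^p$ with matrix-valued kernel $K$: for all $x\in\mathcal{X}$, $v\in\mathbb{R}^p$, $K(\cdot,x)v\in\mathcal{H}$ and $\langle K(\cdot,x)v,f\rangle_{\mathcal{H}}=\langle v,f(x)\rangle$ for all $f\in\mathcal{H}$. $\|\cdot\|$ is the Euclidean norm and $\|\cdot\|_{\mathrm{op}}$ the matrix operator norm. The loss $\ell:\mathbb{R}^p\times\mathbb{R}^p\to\mathbb{R}$ is bounded below and, for every $y\in\mathcal{Y}$, $u\mapsto\ell(y,u)$ is convex and $\rho_p$-Lipschitz on $\mathbb{R}^p$ with $\rho_p\in(0,+\infty)$. $D$ consists of $(X_1,Y_1),\dots,(X_n,Y_n)$, and $\hat f_{\lambda^+;D}$ is the (unique) minimizer over $f\in\mathcal{H}$ of $\frac1n\sum_{i=1}^n\ell(Y_i,f(X_i))+\lambda^+\|f\|_{\mathcal{H}}^2$. Let $S^\Gamma_{\lambda^+;D}(x,u):=\|\Gamma^{-1/2}(u-\hat f_{\lambda^+;D}(x))\|$, $$\widehat\tau^\Gamma_\lambda(x):=\|\Gamma^{-1/2}K(x,x)\Gamma^{-1/2}\|_{\mathrm{op}}^{1/2}\frac{\rho_p\|K(X_{n+1},X_{n+1})\|_{\mathrm{op}}^{1/2}}{2\lambda(n+1)},$$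 $\widetilde S^{\Gamma,\mathrm{up}}(x,u):=S^\Gamma_{\lambda^+;D}(x,u)+\widehat\tau^\Gamma_\lambda(x)$ and $\widetilde S^{\Gamma,\mathrm{lo}}(x,u):=S^\Gamma_{\lambda^+;D}(x,u)-\widehat\tau^\Gamma_\lambda(x)$. The upper StableCP-region is $$\widetilde C^{\Gamma,\mathrm{up}}_{\lambda;\alpha}(X_{n+1}):=\left\{y\in\mathcal{Y}:\frac{1+\sum_{i=1}^n\mathbf{1}\{\widetilde S^{\Gamma,\mathrm{up}}(X_i,Y_i)\ge\widetilde S^{\Gamma,\mathrm{lo}}(X_{n+1},y)\}}{n+1}>\alpha\right\}.$$ *)

theory Defs
  imports "HOL-Analysis.Analysis"
begin

(* A Hilbert space of functions X -> R^p is rendered as a Hilbert space type 'h together with the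
   map ev sending f :: 'h to the function it is: ev is linear on X, and f is determined by the
   values ev f x for x in X.  Values outside X play no role. *)
definition rkhs ::
  "'a set \<Rightarrow> ('h::{real_inner,complete_space} \<Rightarrow> 'a \<Rightarrow> real^'p) \<Rightarrow> ('a \<Rightarrow> 'a \<Rightarrow> real^'p^'p) \<Rightarrow> bool"
  where
  "rkhs X ev K \<longleftrightarrow>
     (\<forall>x\<in>X. linear (\<lambda>f. ev f x)) \<and>
     (\<forall>f g. (\<forall>x\<in>X. ev f x = ev g x) \<longrightarrow> f = g) \<and>
     (\<forall>x\<in>X. \<forall>v. \<exists>k. (\<forall>x'\<in>X. ev k x' = K x' x *v v) \<and> (\<forall>f. k \<bullet> f = v \<bullet> ev f x))"

definition sym_pos_def :: "real^'p^'p \<Rightarrow> bool" where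
  "sym_pos_def A \<longleftrightarrow> transpose A = A \<and> (\<forall>v. v \<noteq> 0 \<longrightarrow> 0 < v \<bullet> (A *v v))"

(* Only meaningful for symmetric positive definite A, where the square root exists uniquely. *)
definition inv_sqrt_mat :: "real^'p^'p \<Rightarrow> real^'p^'p" where
  "inv_sqrt_mat A = matrix_inv (THE B. sym_pos_def B \<and> B ** B = A)"

definition reg_risk ::
  "(real^'p \<Rightarrow> real^'p \<Rightarrow> real) \<Rightarrow> ('h::real_normed_vector \<Rightarrow> 'a \<Rightarrow> real^'p) \<Rightarrow> nat \<Rightarrow>
   (nat \<Rightarrow> 'a) \<Rightarrow> (nat \<Rightarrow> real^'p) \<Rightarrow> real \<Rightarrow> 'h \<Rightarrow> real"
  where
  "reg_risk l ev n xs ys lam f =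
     (1 / real n) * (\<Sum>i=1..n. l (ys i) (ev f (xs i))) + lam * (norm f)\<^sup>2"

(* For a loss convex and continuous in its second argument and bounded below, n > 0 and lam > 0,
   the minimizer over an RKHS exists and is unique, so the choice made by arg_min_on is immaterial. *)
definition predictor ::
  "(real^'p \<Rightarrow> real^'p \<Rightarrow> real) \<Rightarrow> ('h::real_normed_vector \<Rightarrow> 'a \<Rightarrow> real^'p) \<Rightarrow> nat \<Rightarrow>
   (nat \<Rightarrow> 'a) \<Rightarrow> (nat \<Rightarrow> real^'p) \<Rightarrow> real \<Rightarrow> 'a \<Rightarrow> real^'p"
  where
  "predictor l ev n xs ys lam = ev (arg_min_on (reg_risk l ev n xs ys lam) UNIV)"

definition lam_plus :: "nat \<Rightarrow> real \<Rightarrow> real" where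
  "lam_plus n lam = (real n + 1) / real n * lam"

definition score :: "real^'p^'p \<Rightarrow> ('a \<Rightarrow> real^'p) \<Rightarrow> 'a \<Rightarrow> real^'p \<Rightarrow> real" where
  "score \<Gamma> f x u = norm (inv_sqrt_mat \<Gamma> *v (u - f x))"

definition op_norm :: "real^'p^'p \<Rightarrow> real" where
  "op_norm A = onorm (\<lambda>v. A *v v)"

definition tau ::
  "('a \<Rightarrow> 'a \<Rightarrow> real^'p^'p) \<Rightarrow> real^'p^'p \<Rightarrow> real \<Rightarrow> nat \<Rightarrow> (nat \<Rightarrow> 'a) \<Rightarrow> real \<Rightarrow> 'a \<Rightarrow> real"
  where
  "tau K \<Gamma> \<rho> n xs lam x =
     sqrt (op_norm (inv_sqrt_mat \<Gamma> ** K x x ** inv_sqrt_mat \<Gamma>)) *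
     (\<rho> * sqrt (op_norm (K (xs (n+1)) (xs (n+1)))) / (2 * lam * (real n + 1)))"

(* In the next four definitions f is the predictor and t the correction term tau. *)
definition score_up ::
  "real^'p^'p \<Rightarrow> ('a \<Rightarrow> real^'p) \<Rightarrow> ('a \<Rightarrow> real) \<Rightarrow> 'a \<Rightarrow> real^'p \<Rightarrow> real" where
  "score_up \<Gamma> f t x u = score \<Gamma> f x u + t x"

definition score_lo ::
  "real^'p^'p \<Rightarrow> ('a \<Rightarrow> real^'p) \<Rightarrow> ('a \<Rightarrow> real) \<Rightarrow> 'a \<Rightarrow> real^'p \<Rightarrow> real" where
  "score_lo \<Gamma> f t x u = score \<Gamma> f x u - t x"

definition stable_cp_up ::
  "(real^'p) set \<Rightarrow> real^'p^'p \<Rightarrow> ('a \<Rightarrow> real^'p) \<Rightarrow> ('a \<Rightarrow> real) \<Rightarrow> nat \<Rightarrow>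
   (nat \<Rightarrow> 'a) \<Rightarrow> (nat \<Rightarrow> real^'p) \<Rightarrow> real \<Rightarrow> (real^'p) set"
  where
  "stable_cp_up Y \<Gamma> f t n xs ys \<alpha> =
     {y \<in> Y. (1 + (\<Sum>i=1..n. of_bool (score_up \<Gamma> f t (xs i) (ys i) \<ge> score_lo \<Gamma> f t (xs (n+1)) y)))
              / (real n + 1) > \<alpha>}"

(* The i-th smallest value, counted with multiplicity, is entry i - 1 of the sorted list. *)
definition quantile_up ::
  "real^'p^'p \<Rightarrow> ('a \<Rightarrow> real^'p) \<Rightarrow> ('a \<Rightarrow> real) \<Rightarrow> nat \<Rightarrow>
   (nat \<Rightarrow> 'a) \<Rightarrow> (nat \<Rightarrow> real^'p) \<Rightarrow> real \<Rightarrow> real"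
  where
  "quantile_up \<Gamma> f t n xs ys \<alpha> =
     sort (map (\<lambda>j. norm (inv_sqrt_mat \<Gamma> *v (ys j - f (xs j))) + t (xs j)) [1..<n+1])
       ! (nat \<lceil>(real n + 1) * (1 - \<alpha>)\<rceil> - 1)"

end

(* The p-value exceeds alpha iff fewer than (n + 1)(1 - alpha) of the scores lie strictly below
   t = S_lo(X_{n+1}, y); an integer lies below a real iff it lies below its ceiling i, and fewer
   than i values lie below t iff t is at most the i-th smallest value.  The bounds on alpha
   ensure 1 <= i <= n. *)

theory Submission
  imports Defs
begin

text \<open>Sorting preserves the number of entries below \<open>t\<close> and moves them to an
  initial segment of indices, the set \<open>A\<close> in the proof. Position \<open>k\<close>,
  counted from 0, lies outside that segment exactly when the segment has at most \<open>k\<close>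
  elements; ties need no separate treatment.\<close>

lemma le_sort_nth_iff:
  fixes ss :: "'b::linorder list"
  assumes "k < length ss"
  shows "t \<le> sort ss ! k \<longleftrightarrow> length (filter (\<lambda>s. s < t) ss) \<le> k"
proof -
  define zs where "zs = sort ss"
  have k: "k < length zs" and srt: "sorted zs"
    using assms by (simp_all add: zs_def)
  define A where "A = {j. j < length zs \<and> zs ! j < t}"
  have "length (filter (\<lambda>s. s < t) ss) = length (filter (\<lambda>s. s < t) zs)"
    by (simp add: zs_def filter_sort)
  then have len: "length (filter (\<lambda>s. s < t) ss) = card A"
    by (simp add: length_filter_conv_card A_def)
  have "card A \<le> k" if "t \<le> zs ! k"
  proof -
    have "A \<subseteq> {..<k}"
    proof
      fix j assume "j \<in> A"
      then have "j < length zs" "zs ! j < zs ! k"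
        using that by (auto simp: A_def)
      then show "j \<in> {..<k}"
        using sorted_nth_mono[OF srt, of k j] by (auto simp: not_le[symmetric])
    qed
    from card_mono[OF _ this] show ?thesis by simp
  qed
  moreover have "k < card A" if "zs ! k < t"
  proof -
    \<comment> \<open>Every entry up to position \<open>k\<close> is at most \<open>zs ! k\<close>,
      hence below \<open>t\<close>. These are \<open>k + 1\<close> indices, which makes the bound on
      \<open>card A\<close> strict.\<close>
    have "{..k} \<subseteq> A"
      using sorted_nth_mono[OF srt _ k] that k by (fastforce simp: A_def)
    moreover have "finite A" by (simp add: A_def)
    ultimately have "card {..k} \<le> card A" by (rule card_mono[rotated])
    then show ?thesis by simp
  qed
  ultimately show ?thesis
    unfolding len zs_def[symmetric] by (meson not_le)
qed

lemma sum_of_bool_eq_length_filter: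
  "(\<Sum>i=1..n. of_bool (P (g i))) = real (length (filter P (map g [1..<n+1])))"
  by (induction n) auto

text \<open>The scores are abstracted to an arbitrary real sequence \<open>g\<close> and threshold
  \<open>t\<close>, which leaves a pure statement about order statistics.\<close>

lemma conformal_count_iff:
  fixes g :: "nat \<Rightarrow> real"
  assumes "n \<ge> 1" "1 / (real n + 1) \<le> \<alpha>" "\<alpha> < 1"
  shows "(1 + (\<Sum>i=1..n. of_bool (g i \<ge> t))) / (real n + 1) > \<alpha> \<longleftrightarrow>
    t \<le> sort (map g [1..<n+1]) ! (nat \<lceil>(real n + 1) * (1 - \<alpha>)\<rceil> - 1)"
proof -
  define ss where "ss = map g [1..<n+1]"
  define x where "x = (real n + 1) * (1 - \<alpha>)"
  define m where "m = length (filter (\<lambda>s. s < t) ss)"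
  have len: "length ss = n" by (simp add: ss_def)
  have "0 < x" using assms by (simp add: x_def)
  moreover have "x \<le> real n" using assms by (simp add: x_def field_simps)
  ultimately have i: "1 \<le> nat \<lceil>x\<rceil>" "nat \<lceil>x\<rceil> - 1 < length ss"
    using \<open>n \<ge> 1\<close> unfolding len by linarith+
  have "length (filter (\<lambda>s. t \<le> s) ss) + m = n"
    using sum_length_filter_compl[of "\<lambda>s. s < t" ss] by (simp add: m_def len not_less)
  then have count: "(\<Sum>i=1..n. of_bool (g i \<ge> t)) = real n - real m"
    unfolding sum_of_bool_eq_length_filter[of "\<lambda>s. t \<le> s" g] ss_def[symmetric] by linarith
  \<comment> \<open>The leading 1 completes \<open>n - m\<close> to \<open>(n + 1) - m\<close>, so
    clearing the denominator leaves exactly \<open>m < (n + 1) * (1 - \<alpha>)\<close>.\<close>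
  then have "(1 + (\<Sum>i=1..n. of_bool (g i \<ge> t))) / (real n + 1) > \<alpha> \<longleftrightarrow> real m < x"
    unfolding count by (simp add: x_def field_simps)
  also have "\<dots> \<longleftrightarrow> m < nat \<lceil>x\<rceil>" by linarith
  \<comment> \<open>Subtraction on \<open>nat\<close> truncates at 0; \<open>i(1)\<close> guarantees
    that it is exact here.\<close>
  also have "\<dots> \<longleftrightarrow> m \<le> nat \<lceil>x\<rceil> - 1" using i(1) by linarith
  also have "\<dots> \<longleftrightarrow> t \<le> sort ss ! (nat \<lceil>x\<rceil> - 1)"
    unfolding m_def using le_sort_nth_iff[OF i(2)] by simp
  finally show ?thesis unfolding ss_def x_def .
qed

theorem mainTheorem5:
  fixes X :: "(real^'d) set" and Y :: "(real^'p) set"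
    and xs :: "nat \<Rightarrow> real^'d" and ys :: "nat \<Rightarrow> real^'p" and n :: nat
    and lam \<rho> \<alpha> :: real
    and \<Gamma> :: "real^'p^'p"
    and ev :: "'h::{real_inner,complete_space} \<Rightarrow> real^'d \<Rightarrow> real^'p"
    and K :: "real^'d \<Rightarrow> real^'d \<Rightarrow> real^'p^'p"
    and l :: "real^'p \<Rightarrow> real^'p \<Rightarrow> real"
  assumes "n \<ge> 1"
    and "\<And>i. i \<in> {1..n+1} \<Longrightarrow> xs i \<in> X"
    and "\<And>i. i \<in> {1..n} \<Longrightarrow> ys i \<in> Y"
    and "lam > 0"
    and "sym_pos_def \<Gamma>"
    and "rkhs X ev K"
    and "\<exists>c. \<forall>y u. c \<le> l y u"
    and "\<rho> > 0"
    and "\<And>y. y \<in> Y \<Longrightarrow> convex_on UNIV (l y)"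
    and "\<And>y. y \<in> Y \<Longrightarrow> \<rho>-lipschitz_on UNIV (l y)"
    and "1 / (real n + 1) \<le> \<alpha>" and "\<alpha> < 1"
  shows
    "stable_cp_up Y \<Gamma> (predictor l ev n xs ys (lam_plus n lam)) (tau K \<Gamma> \<rho> n xs lam) n xs ys \<alpha> =
     {y \<in> Y.
        norm (inv_sqrt_mat \<Gamma> *v (y - predictor l ev n xs ys (lam_plus n lam) (xs (n+1))))
        \<le> quantile_up \<Gamma> (predictor l ev n xs ys (lam_plus n lam)) (tau K \<Gamma> \<rho> n xs lam) n xs ys \<alpha>
           + tau K \<Gamma> \<rho> n xs lam (xs (n+1))}"
  unfolding stable_cp_up_def quantile_up_def score_up_def score_lo_def score_def
    conformal_count_iff[OF assms(1,11,12)]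
  \<comment> \<open>The threshold is the lower score at the test point; moving its correction term
    to the other side adds it to the quantile and gives the radius.\<close>
  by (simp only: diff_le_eq)

end
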